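(* Let $a_1,a_2,b_1,b_2,c_1,c_2$ be real numbers with $0\le a_1<1$, $0<b_1<1$, $a_2,b_2,c_2>0$ and $c_1>1$. There exist constants $L_1,L_2$, which depend on the parameters $a_1,a_2,b_1,b_2,c_1,c_2$ but are independent of the threshold $\rho$ below, such that the following holds for every $\rho>0$, every $\sigma\ge0$ and all real sequences $(\eta_t),(\epsilon_t),(\xi_t)$, $t\in\mathbb N$, with $$m=\sup_t\max\{|\epsilon_t|,|\eta_t|,|\xi_t|\}<\infty .$$ Every trajectory of the system $$x_t=b_1p_t+(1-b_1)x_{t-1}+b_2y_t+\eta_t,$$ $$y_t=(1-a_1)y_{t-1}-a_2(r_t-p_t)+\epsilon_t,$$ $$p_t=x_t+\Phi_\rho(p_{t-1}-x_t),$$ $$r_t=g_t+\xi_t,\qquad g_t=(c_1x_t+c_2y_t)+\Phi_\sigma\big(g_{t-1}-(c_1x_t+c_2y_t)\big),\qquad t\in\mathbb N,$$ with initial data satisfying $|x_0-p_0|\le\rho$ and $g_0=r_0$, $|r_0-(c_1x_0+c_2y_0)|\le\sigma$, satisfies $$\limsup_{t\to\infty}|x_t-x_*(s_t)|\le L_1\sigma+L_2m,\qquad \limsup_{t\to\infty}|y_t-y_*(s_t)|\le L_1\sigma+L_2m,$$ where $s_t=x_t-p_t$ and, for $|u|\le\rho$, $$x_*(u)=\kappa u,\qquad y_*(u)=\frac{b_1}{b_2}u,\qquad \kappa=\frac{a_2(b_2+b_1c_2)+a_1b_1}{a_2b_2(1-c_1)}.$$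
   Context: For $\rho\ge0$, $\Phi_\rho:\mathbb R\to\mathbb R$ is the saturation function: $\Phi_\rho(v)=\rho$ if $v\ge\rho$, $\Phi_\rho(v)=v$ if $-\rho<v<\rho$, $\Phi_\rho(v)=-\rho$ if $v\le-\rho$ (so $\Phi_0\equiv0$). The equations are implicit; a trajectory is any collection of real sequences $(x_t),(y_t),(p_t),(r_t),(g_t)$, $t\in\mathbb N\cup\{0\}$, satisfying the initial constraints and all the equations for every $t\in\mathbb N$. The sequence $g_t$ is the output of the play operator with threshold $\sigma$ applied to the input $c_1x_t+c_2y_t$. The numbers $\sigma$ and $\rho$ are independent of each other. *)

theory Defs
  imports "HOL-Analysis.Analysis"
begin

definition saturation :: "real \<Rightarrow> real \<Rightarrow> real" where
  "saturation \<rho> v = (if v \<ge> \<rho> then \<rho> else if - \<rho> < v then v else - \<rho>)"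

text \<open>The noise sequences are indexed by positive times; their values at time 0 are irrelevant.
  For real sequences, finiteness of the supremum is expressed by boundedness.\<close>

definition noise_at :: "(nat \<Rightarrow> real) \<Rightarrow> (nat \<Rightarrow> real) \<Rightarrow> (nat \<Rightarrow> real) \<Rightarrow> nat \<Rightarrow> real" where
  "noise_at \<eta> \<epsilon> \<xi> t = Max {\<bar>\<epsilon> t\<bar>, \<bar>\<eta> t\<bar>, \<bar>\<xi> t\<bar>}"

definition bounded_noise :: "(nat \<Rightarrow> real) \<Rightarrow> (nat \<Rightarrow> real) \<Rightarrow> (nat \<Rightarrow> real) \<Rightarrow> bool" where
  "bounded_noise \<eta> \<epsilon> \<xi> \<longleftrightarrow> bdd_above (noise_at \<eta> \<epsilon> \<xi> ` {1..})"

definition noise_sup :: "(nat \<Rightarrow> real) \<Rightarrow> (nat \<Rightarrow> real) \<Rightarrow> (nat \<Rightarrow> real) \<Rightarrow> real" where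
  "noise_sup \<eta> \<epsilon> \<xi> = (SUP t\<in>{1..}. noise_at \<eta> \<epsilon> \<xi> t)"

text \<open>The equations at time \<open>t \<ge> 1\<close> are implicit in the values at time \<open>t\<close>, so a trajectory is
  any tuple of sequences satisfying them; neither existence nor uniqueness is built in.\<close>

definition trajectory ::
  "real \<Rightarrow> real \<Rightarrow> real \<Rightarrow> real \<Rightarrow> real \<Rightarrow> real \<Rightarrow> real \<Rightarrow> real \<Rightarrow>
   (nat \<Rightarrow> real) \<Rightarrow> (nat \<Rightarrow> real) \<Rightarrow> (nat \<Rightarrow> real) \<Rightarrow>
   (nat \<Rightarrow> real) \<Rightarrow> (nat \<Rightarrow> real) \<Rightarrow> (nat \<Rightarrow> real) \<Rightarrow> (nat \<Rightarrow> real) \<Rightarrow> (nat \<Rightarrow> real) \<Rightarrow> bool"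
where
  "trajectory a1 a2 b1 b2 c1 c2 \<rho> \<sigma> \<eta> \<epsilon> \<xi> x y p r g \<longleftrightarrow>
     \<bar>x 0 - p 0\<bar> \<le> \<rho> \<and>
     g 0 = r 0 \<and>
     \<bar>r 0 - (c1 * x 0 + c2 * y 0)\<bar> \<le> \<sigma> \<and>
     (\<forall>t\<ge>1.
        x t = b1 * p t + (1 - b1) * x (t - 1) + b2 * y t + \<eta> t \<and>
        y t = (1 - a1) * y (t - 1) - a2 * (r t - p t) + \<epsilon> t \<and>
        p t = x t + saturation \<rho> (p (t - 1) - x t) \<and>
        r t = g t + \<xi> t \<and>
        g t = (c1 * x t + c2 * y t) + saturation \<sigma> (g (t - 1) - (c1 * x t + c2 * y t)))"

definition kappa :: "real \<Rightarrow> real \<Rightarrow> real \<Rightarrow> real \<Rightarrow> real \<Rightarrow> real \<Rightarrow> real" where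
  "kappa a1 a2 b1 b2 c1 c2 = (a2 * (b2 + b1 * c2) + a1 * b1) / (a2 * b2 * (1 - c1))"

text \<open>The equilibrium maps are used only on \<open>[-\<rho>, \<rho>]\<close>, which contains \<open>x t - p t\<close> for every
  trajectory; outside this interval they are extended by the same formulas.\<close>

definition x_star :: "real \<Rightarrow> real \<Rightarrow> real \<Rightarrow> real \<Rightarrow> real \<Rightarrow> real \<Rightarrow> real \<Rightarrow> real" where
  "x_star a1 a2 b1 b2 c1 c2 u = kappa a1 a2 b1 b2 c1 c2 * u"

definition y_star :: "real \<Rightarrow> real \<Rightarrow> real \<Rightarrow> real" where
  "y_star b1 b2 u = b1 / b2 * u"

end

theory Submission
  imports Defs
begin

text \<open>Put \<open>s = x - p\<close>, \<open>v t = x t - x (t - 1)\<close> and \<open>z = x - \<kappa> * s\<close>. The sequence \<open>s\<close> is the output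
  of a stop operator, so its increments are \<open>\<theta> t * v t\<close> with \<open>\<theta> t \<in> [0,1]\<close>. Since the play operator
  with threshold \<open>\<sigma>\<close> differs from the identity by at most \<open>\<sigma>\<close>, the pair \<open>(v, z)\<close> satisfies the
  implicit Euler scheme of a damped oscillator
  \<open>Q * (v t - v (t - 1)) = - d t * v t - k * z t + e t\<close>, \<open>z t - z (t - 1) = \<psi> t * v t\<close>, where
  \<open>\<psi> = 1 - \<kappa> * \<theta>\<close> depends on time and \<open>e\<close> is of the order of \<open>\<sigma> + m\<close>; the threshold \<open>\<rho>\<close> has
  disappeared. The energy \<open>Q * \<psi> * v^2 + k * z^2\<close> could grow only through an increase of \<open>\<psi>\<close>,
  but the stop operator allows this only when \<open>v\<close> changes sign, and then the numerical dissipation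
  \<open>Q * \<psi> * (v t - v (t - 1))^2\<close> of the implicit scheme compensates it. A small multiple of
  \<open>v * z\<close> added to the energy makes the decay exponential.\<close>

section \<open>Energy estimates for one step of the implicit scheme\<close>

lemma young_mult:
  fixes a b c :: real
  assumes "c > 0"
  shows "2 * a * b \<le> c * a\<^sup>2 + b\<^sup>2 / c"
proof -
  have "0 \<le> (c * a - b)\<^sup>2 / c" using assms by simp
  also have "\<dots> = c * a\<^sup>2 + b\<^sup>2 / c - 2 * a * b"
    using assms by (simp add: field_simps power2_eq_square)
  finally show ?thesis by simp
qed

text \<open>The identity
  \<open>v\<^sup>2 - v'\<^sup>2 = 2 * v * (v - v') - (v - v')\<^sup>2\<close>, and the same one for
  \<open>z\<close>, leave a dissipative square. The mixed terms in \<open>v * z\<close> cancel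
  because the weight of \<open>v\<^sup>2\<close> is \<open>Q * \<psi>\<close>. A growing weight
  costs \<open>(\<psi> - \<psi>') * v'\<^sup>2\<close>, and at a sign change
  \<open>v'\<^sup>2 \<le> (v - v')\<^sup>2\<close>, so the dissipative square pays for it.\<close>

lemma energy_step:
  fixes v v' z z' e \<psi> \<psi>' d Q k :: real
  assumes "Q > 0" "\<psi> > 0" "\<psi>' \<ge> 0"
    and jump: "\<psi>' < \<psi> \<Longrightarrow> v * v' \<le> 0"
    and v: "Q * (v - v') = - d * v - k * z + e"
    and z: "z - z' = \<psi> * v"
  shows "(Q * \<psi> * v\<^sup>2 + k * z\<^sup>2) - (Q * \<psi>' * v'\<^sup>2 + k * z'\<^sup>2)
    \<le> - 2 * \<psi> * d * v\<^sup>2 - k * (\<psi> * v)\<^sup>2 + 2 * \<psi> * v * e"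
proof -
  have "(Q * \<psi> * v\<^sup>2 + k * z\<^sup>2) - (Q * \<psi>' * v'\<^sup>2 + k * z'\<^sup>2)
    = 2 * \<psi> * v * (Q * (v - v')) + 2 * k * z * (z - z') - k * (z - z')\<^sup>2
      + Q * ((\<psi> - \<psi>') * v'\<^sup>2 - \<psi> * (v - v')\<^sup>2)"
    by (simp add: power2_eq_square algebra_simps)
  moreover have "(\<psi> - \<psi>') * v'\<^sup>2 \<le> \<psi> * (v - v')\<^sup>2"
  proof (cases "\<psi>' < \<psi>")
    case True
    have "v'\<^sup>2 \<le> (v - v')\<^sup>2"
      using jump[OF True] zero_le_power2[of v] unfolding power2_diff by linarith
    then show ?thesis
      using assms(2,3) True by (intro mult_mono) auto
  next
    case False
    then have "(\<psi> - \<psi>') * v'\<^sup>2 \<le> 0"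
      by (simp add: mult_nonpos_nonneg)
    also have "0 \<le> \<psi> * (v - v')\<^sup>2" using assms(2) by simp
    finally show ?thesis .
  qed
  then have "Q * ((\<psi> - \<psi>') * v'\<^sup>2 - \<psi> * (v - v')\<^sup>2) \<le> 0"
    using \<open>Q > 0\<close> by (simp add: mult_nonneg_nonpos)
  ultimately show ?thesis unfolding v z
    by (simp add: power2_eq_square algebra_simps)
qed

text \<open>The energy balance damps only \<open>v\<close>; the product \<open>v * z\<close>
  supplies the missing term \<open>- k * z\<^sup>2\<close>.\<close>

lemma cross_step:
  fixes v v' z z' e \<psi> d Q k :: real
  assumes v: "Q * (v - v') = - d * v - k * z + e"
    and z: "z - z' = \<psi> * v"
  shows "Q * v * z - Q * v' * z'
    = - k * z\<^sup>2 + (\<psi> * k - d) * v * z + e * z - \<psi> * v * e + \<psi> * (Q + d) * v\<^sup>2"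
proof -
  \<comment> \<open>Solving the scheme for the old velocity leaves only new values on the right, as
    in the energy balance.\<close>
  have v': "Q * v' = Q * v + d * v + k * z - e" using v by (simp add: algebra_simps)
  have "Q * v * z - Q * v' * z' = (Q * (v - v')) * z + (Q * v') * (z - z')"
    by (simp add: algebra_simps)
  then show ?thesis unfolding v v' z by (simp add: power2_eq_square algebra_simps)
qed

text \<open>The energy balance plus \<open>2 * \<mu>\<close> times the cross balance. The condition
  on \<open>\<mu>\<close> keeps the part of the cross term that is quadratic in \<open>v\<close>
  below half of the available damping \<open>2 * d0 * v\<^sup>2\<close>; all other mixed terms are
  split by Young's inequality.\<close>

lemma lyapunov_step:
  fixes v v' z z' e \<psi> \<psi>' d Q k \<mu> d0 d1 \<Psi> :: real
  assumes pos: "Q > 0" "k > 0" "d0 > 0" "\<mu> > 0"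
    and \<psi>: "1 \<le> \<psi>" "\<psi> \<le> \<Psi>" "1 \<le> \<psi>'" and d: "d0 \<le> d" "d \<le> d1"
    and \<mu>: "\<mu> * ((\<Psi> * k + d1)\<^sup>2 / k + 2 * \<Psi> * (Q + d1)) \<le> d0"
    and jump: "\<psi>' < \<psi> \<Longrightarrow> v * v' \<le> 0"
    and v: "Q * (v - v') = - d * v - k * z + e"
    and z: "z - z' = \<psi> * v"
  shows "(Q * \<psi> * v\<^sup>2 + k * z\<^sup>2 + 2 * \<mu> * (Q * v * z)) - (Q * \<psi>' * v'\<^sup>2 + k * z'\<^sup>2 + 2 * \<mu> * (Q * v' * z'))
    \<le> - (d0 / 2) * v\<^sup>2 - (\<mu> * k / 2) * z\<^sup>2 + (2 * (\<Psi> * (1 + \<mu>))\<^sup>2 / d0 + 2 * \<mu> / k) * e\<^sup>2"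
proof -
  define K where "K = \<Psi> * k + d1"
  have E: "(Q * \<psi> * v\<^sup>2 + k * z\<^sup>2) - (Q * \<psi>' * v'\<^sup>2 + k * z'\<^sup>2)
      \<le> - 2 * \<psi> * d * v\<^sup>2 - k * (\<psi> * v)\<^sup>2 + 2 * \<psi> * v * e"
    using pos \<psi> by (intro energy_step jump v z) auto
  have "d0 \<le> \<psi> * d" using \<psi>(1) d(1) pos(3) mult_mono[of 1 \<psi> d0 d] by simp
  then have 1: "d0 * v\<^sup>2 \<le> \<psi> * d * v\<^sup>2" by (simp add: mult_right_mono)
  have 2: "0 \<le> k * (\<psi> * v)\<^sup>2" using pos by simp
  have 3: "2 * \<mu> * ((\<psi> * k - d) * v * z) \<le> \<mu> * (k * z\<^sup>2 + K\<^sup>2 / k * v\<^sup>2)"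
  proof -
    have "\<psi> * k \<le> \<Psi> * k" using \<psi> pos by simp
    moreover have "0 \<le> \<psi> * k" using \<psi> pos by simp
    ultimately have "\<bar>\<psi> * k - d\<bar> \<le> K" using d pos unfolding K_def by linarith
    then have "(\<psi> * k - d)\<^sup>2 \<le> K\<^sup>2" by (meson abs_le_square_iff abs_ge_self order_trans)
    then have *: "(\<psi> * k - d)\<^sup>2 / k * v\<^sup>2 \<le> K\<^sup>2 / k * v\<^sup>2"
      using pos by (intro mult_right_mono divide_right_mono) auto
    have "2 * z * ((\<psi> * k - d) * v) \<le> k * z\<^sup>2 + ((\<psi> * k - d) * v)\<^sup>2 / k"
      by (rule young_mult) (fact pos)
    with * have "2 * z * ((\<psi> * k - d) * v) \<le> k * z\<^sup>2 + K\<^sup>2 / k * v\<^sup>2"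
      by (simp add: power_mult_distrib)
    then have "\<mu> * (2 * z * ((\<psi> * k - d) * v)) \<le> \<mu> * (k * z\<^sup>2 + K\<^sup>2 / k * v\<^sup>2)"
      using pos by (intro mult_left_mono) auto
    then show ?thesis by (simp add: mult_ac)
  qed
  have 4: "2 * \<mu> * (\<psi> * (Q + d) * v\<^sup>2) \<le> \<mu> * (2 * \<Psi> * (Q + d1)) * v\<^sup>2"
  proof -
    have "\<psi> * (Q + d) \<le> \<Psi> * (Q + d1)" using \<psi> d pos by (intro mult_mono) auto
    then have "2 * \<mu> * v\<^sup>2 * (\<psi> * (Q + d)) \<le> 2 * \<mu> * v\<^sup>2 * (\<Psi> * (Q + d1))"
      using pos by (intro mult_left_mono) auto
    then show ?thesis by (simp only: mult_ac)
  qed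
  \<comment> \<open>This is where the smallness of \<open>\<mu>\<close> enters: the left side
    collects the costs in \<open>v\<^sup>2\<close> of the two preceding estimates.\<close>
  have 5: "\<mu> * (K\<^sup>2 / k * v\<^sup>2) + \<mu> * (2 * \<Psi> * (Q + d1)) * v\<^sup>2 \<le> d0 * v\<^sup>2"
    using mult_right_mono[OF \<mu>, of "v\<^sup>2"] unfolding K_def by (simp add: algebra_simps)
  \<comment> \<open>Both forcing terms in \<open>v\<close> combine to the coefficient
    \<open>\<psi> * (1 - \<mu>)\<close>; Young's inequality has weight
    \<open>d0 / 2\<close>.\<close>
  have 6: "2 * \<psi> * v * e + 2 * \<mu> * (- \<psi> * v * e) \<le> d0 / 2 * v\<^sup>2 + 2 * (\<Psi> * (1 + \<mu>))\<^sup>2 / d0 * e\<^sup>2"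
  proof -
    have "\<bar>\<psi> * (1 - \<mu>)\<bar> \<le> \<Psi> * (1 + \<mu>)"
      unfolding abs_mult using \<psi> pos by (intro mult_mono) auto
    then have "(\<psi> * (1 - \<mu>))\<^sup>2 \<le> (\<Psi> * (1 + \<mu>))\<^sup>2" by (meson abs_le_square_iff abs_ge_self order_trans)
    then have "(\<psi> * (1 - \<mu>))\<^sup>2 * e\<^sup>2 / (d0 / 2) \<le> (\<Psi> * (1 + \<mu>))\<^sup>2 * e\<^sup>2 / (d0 / 2)"
      using pos by (intro mult_right_mono divide_right_mono) auto
    moreover have "2 * v * (\<psi> * (1 - \<mu>) * e) \<le> d0 / 2 * v\<^sup>2 + (\<psi> * (1 - \<mu>) * e)\<^sup>2 / (d0 / 2)"
      by (rule young_mult) (use pos in simp)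
    ultimately have "2 * v * (\<psi> * (1 - \<mu>) * e) \<le> d0 / 2 * v\<^sup>2 + (\<Psi> * (1 + \<mu>))\<^sup>2 * e\<^sup>2 / (d0 / 2)"
      unfolding power_mult_distrib[of _ e] by linarith
    moreover have "2 * v * (\<psi> * (1 - \<mu>) * e) = 2 * \<psi> * v * e + 2 * \<mu> * (- \<psi> * v * e)"
      by (simp add: algebra_simps)
    ultimately show ?thesis by (simp add: mult_ac)
  qed
  have 7: "2 * \<mu> * (e * z) \<le> \<mu> * k / 2 * z\<^sup>2 + 2 * \<mu> / k * e\<^sup>2"
    using young_mult[of "\<mu> * k / 2" z "\<mu> * e"] pos
    by (simp add: power_mult_distrib power2_eq_square mult_ac)
  have "2 * \<mu> * (Q * v * z) - 2 * \<mu> * (Q * v' * z')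
    = 2 * \<mu> * (- k * z\<^sup>2 + (\<psi> * k - d) * v * z + e * z - \<psi> * v * e + \<psi> * (Q + d) * v\<^sup>2)"
    using cross_step[OF v z] by (simp flip: right_diff_distrib)
  also have "\<dots> = - 2 * (\<mu> * k * z\<^sup>2) + 2 * \<mu> * ((\<psi> * k - d) * v * z) + 2 * \<mu> * (e * z)
      + 2 * \<mu> * (- \<psi> * v * e) + 2 * \<mu> * (\<psi> * (Q + d) * v\<^sup>2)"
    by (simp add: algebra_simps)
  finally have G: "2 * \<mu> * (Q * v * z) - 2 * \<mu> * (Q * v' * z') = \<dots>" .
  have 3: "2 * \<mu> * ((\<psi> * k - d) * v * z) \<le> \<mu> * k * z\<^sup>2 + \<mu> * (K\<^sup>2 / k * v\<^sup>2)"
    using 3 by (simp add: distrib_left mult_ac)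
  \<comment> \<open>The budget: \<open>- 2 * d0 + d0 + d0 / 2 = - d0 / 2\<close> for
    \<open>v\<^sup>2\<close> and \<open>- 2 * \<mu> * k + \<mu> * k + \<mu> * k / 2 = - \<mu> * k /
    2\<close> for \<open>z\<^sup>2\<close>.\<close>
  have "\<mu> * k / 2 * z\<^sup>2 = (\<mu> * k * z\<^sup>2) / 2" by simp
  moreover have "d0 / 2 * v\<^sup>2 = d0 * v\<^sup>2 / 2" by simp
  moreover have "- 2 * \<psi> * d * v\<^sup>2 = - 2 * (\<psi> * d * v\<^sup>2)" by simp
  ultimately show ?thesis
    using E G 1 2 3 4 5 6 7 unfolding distrib_right by linarith
qed

section \<open>Exponential decay and the oscillator bound\<close>

text \<open>The decay term is implicit, so the excess of \<open>F\<close> over the fixed point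
  \<open>A / c\<close> shrinks by the factor \<open>1 / (1 + c)\<close> in each step.\<close>

lemma contraction_eventually_le:
  fixes F :: "nat \<Rightarrow> real"
  assumes "c > 0" "\<delta> > 0"
    and step: "\<And>t. t \<ge> N \<Longrightarrow> F (Suc t) - F t \<le> - c * F (Suc t) + A"
  shows "\<forall>\<^sub>F t in sequentially. F t \<le> A / c + \<delta>"
proof -
  define q where "q = 1 / (1 + c)"
  have q: "0 < q" "q < 1" using assms(1) by (auto simp: q_def)
  have *: "F (N + n) - A / c \<le> q ^ n * (F N - A / c)" for n
  proof (induction n)
    case (Suc n)
    have "(1 + c) * (F (Suc (N + n)) - A / c) \<le> F (N + n) - A / c"
      using step[of "N + n"] assms(1) by (simp add: algebra_simps add_divide_distrib)
    then have "F (Suc (N + n)) - A / c \<le> q * (F (N + n) - A / c)"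
      using assms(1) by (simp add: q_def pos_le_divide_eq mult.commute)
    also have "\<dots> \<le> q * (q ^ n * (F N - A / c))"
      using Suc.IH q by (intro mult_left_mono) auto
    finally show ?case by (simp add: mult_ac)
  qed simp
  have "(\<lambda>n. q ^ n * (F N - A / c)) \<longlonglongrightarrow> 0"
    using q by (intro tendsto_mult_left_zero LIMSEQ_realpow_zero) auto
  then have "\<forall>\<^sub>F n in sequentially. q ^ n * (F N - A / c) < \<delta>"
    using assms(2) by (rule order_tendstoD)
  then have "\<forall>\<^sub>F n in sequentially. F (n + N) \<le> A / c + \<delta>"
  proof eventually_elim
    case (elim n)
    then show ?case using *[of n] by (simp add: add.commute)
  qed
  then show ?thesis
    by (rule eventually_sequentially_seg[of "\<lambda>t. F t \<le> A / c + \<delta>" N, THEN iffD1])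
qed

text \<open>The quantifier order matters: \<open>A\<close> depends only on the bounds of the
  coefficients and serves all sequences, which later makes it independent of
  \<open>\<rho>\<close>.\<close>

lemma switched_oscillator_bound:
  fixes Q k d0 d1 \<Psi> :: real
  assumes pos: "Q > 0" "k > 0" "d0 > 0" and "d0 \<le> d1" "1 \<le> \<Psi>"
  shows "\<exists>A\<ge>0. \<forall>v z e \<psi> d M N. \<forall>\<delta>>0.
    (\<forall>t\<ge>N. 1 \<le> \<psi> t \<and> \<psi> t \<le> \<Psi> \<and> d0 \<le> d t \<and> d t \<le> d1 \<and> \<bar>e t\<bar> \<le> M \<and>
      (\<psi> t < \<psi> (Suc t) \<longrightarrow> v (Suc t) * v t \<le> 0) \<and>
      Q * (v (Suc t) - v t) = - d (Suc t) * v (Suc t) - k * z (Suc t) + e (Suc t) \<and>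
      z (Suc t) - z t = \<psi> (Suc t) * v (Suc t)) \<longrightarrow>
    (\<forall>\<^sub>F t in sequentially. \<bar>v t\<bar> \<le> A * M + \<delta> \<and> \<bar>z t\<bar> \<le> A * M + \<delta>)"
proof -
  define R where "R = (\<Psi> * k + d1)\<^sup>2 / k + 2 * \<Psi> * (Q + d1)"
  have "R > 0" unfolding R_def using assms by (intro add_nonneg_pos) auto
  \<comment> \<open>The entry \<open>d0 / R\<close> gives the smallness condition of the Lyapunov
    step; the other two give \<open>4 * Q * \<mu>\<^sup>2 \<le> k\<close>, which makes the Lyapunov
    function positive definite.\<close>
  define \<mu> where "\<mu> = Min {1, k / (4 * Q), d0 / R}"
  have \<mu>: "\<mu> > 0" "\<mu> \<le> 1" "\<mu> \<le> k / (4 * Q)" "\<mu> \<le> d0 / R"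
    using pos \<open>R > 0\<close> unfolding \<mu>_def by auto
  have \<mu>R: "\<mu> * R \<le> d0" using \<mu>(4) \<open>R > 0\<close> by (simp add: field_simps)
  have "\<mu>\<^sup>2 \<le> \<mu>" using \<mu> by (simp add: power2_eq_square mult_left_le)
  also note \<mu>(3)
  finally have \<mu>2: "\<mu>\<^sup>2 * (4 * Q) \<le> k" using pos by (simp add: field_simps)
  \<comment> \<open>Here \<open>h\<close> is the decay coefficient of
    \<open>v\<^sup>2 + z\<^sup>2\<close>, \<open>l\<close> and \<open>H\<close> compare the Lyapunov
    function with this sum from below and above, and \<open>C\<close> multiplies the forcing. The
    choice of \<open>A\<close> comes from
    \<open>l * (v\<^sup>2 + z\<^sup>2) \<le> C * M\<^sup>2 / c\<close> in the limit.\<close>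
  define h where "h = min (d0 / 2) (\<mu> * k / 2)"
  define H where "H = max (Q * \<Psi> + \<mu> * Q) (k + \<mu> * Q)"
  define l where "l = min Q k / 2"
  define C where "C = 2 * (\<Psi> * (1 + \<mu>))\<^sup>2 / d0 + 2 * \<mu> / k"
  define c where "c = h / H"
  define A where "A = sqrt (C / c / l)"
  have hHl: "h > 0" "H > 0" "l > 0" "c > 0" "C \<ge> 0"
    using pos \<mu> unfolding h_def H_def l_def c_def C_def
    by (auto simp: max_def min_def add_pos_pos divide_pos_pos not_le)
  have "A \<ge> 0" using hHl unfolding A_def by simp
  moreover have "\<forall>\<^sub>F t in sequentially. \<bar>v t\<bar> \<le> A * M + \<delta> \<and> \<bar>z t\<bar> \<le> A * M + \<delta>"
    if "\<delta> > 0" and hyp: "\<And>t. t \<ge> N \<Longrightarrow> 1 \<le> \<psi> t \<and> \<psi> t \<le> \<Psi> \<and> d0 \<le> d t \<and> d t \<le> d1 \<and> \<bar>e t\<bar> \<le> M \<and>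
      (\<psi> t < \<psi> (Suc t) \<longrightarrow> v (Suc t) * v t \<le> 0) \<and>
      Q * (v (Suc t) - v t) = - d (Suc t) * v (Suc t) - k * z (Suc t) + e (Suc t) \<and>
      z (Suc t) - z t = \<psi> (Suc t) * v (Suc t)"
    for v z e \<psi> d :: "nat \<Rightarrow> real" and M \<delta> :: real and N
  proof -
    define F where "F t = Q * \<psi> t * (v t)\<^sup>2 + k * (z t)\<^sup>2 + 2 * \<mu> * (Q * v t * z t)" for t
    have "M \<ge> 0" using hyp[of N] by force
    have upper: "F t \<le> H * ((v t)\<^sup>2 + (z t)\<^sup>2)" if "t \<ge> N" for t
    proof -
      have "2 * \<mu> * (Q * v t * z t) \<le> \<mu> * Q * ((v t)\<^sup>2 + (z t)\<^sup>2)"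
        using mult_left_mono[OF young_mult[of 1 "v t" "z t"], of "\<mu> * Q"] \<mu> pos
        by (simp add: mult_ac)
      moreover have "Q * \<psi> t * (v t)\<^sup>2 \<le> Q * \<Psi> * (v t)\<^sup>2"
        using hyp[OF that] pos by (intro mult_right_mono mult_left_mono) auto
      ultimately have "F t \<le> (Q * \<Psi> + \<mu> * Q) * (v t)\<^sup>2 + (k + \<mu> * Q) * (z t)\<^sup>2"
        unfolding F_def by (simp add: algebra_simps)
      also have "\<dots> \<le> H * (v t)\<^sup>2 + H * (z t)\<^sup>2"
        unfolding H_def by (intro add_mono mult_right_mono) auto
      finally show ?thesis by (simp add: distrib_left)
    qed
    \<comment> \<open>The cross term uses up at most half of
      \<open>Q * v\<^sup>2 + k * z\<^sup>2\<close>, and \<open>1 \<le> \<psi> t\<close> controls the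
      weight.\<close>
    have lower: "l * ((v t)\<^sup>2 + (z t)\<^sup>2) \<le> F t" if "t \<ge> N" for t
    proof -
      have "2 * (v t) * (- (2 * \<mu> * z t)) \<le> 1 * (v t)\<^sup>2 + (- (2 * \<mu> * z t))\<^sup>2 / 1"
        by (rule young_mult) simp
      then have "- (2 * \<mu> * (v t * z t)) \<le> (v t)\<^sup>2 / 2 + 2 * \<mu>\<^sup>2 * (z t)\<^sup>2"
        by (simp add: power_mult_distrib mult_ac)
      then have "Q * (- (2 * \<mu> * (v t * z t))) \<le> Q * ((v t)\<^sup>2 / 2 + 2 * \<mu>\<^sup>2 * (z t)\<^sup>2)"
        using pos by (intro mult_left_mono) auto
      also have "\<dots> = Q / 2 * (v t)\<^sup>2 + \<mu>\<^sup>2 * (4 * Q) * (z t)\<^sup>2 / 2"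
        by (simp add: algebra_simps)
      also have "\<dots> \<le> Q / 2 * (v t)\<^sup>2 + k * (z t)\<^sup>2 / 2"
        using \<mu>2 by (intro add_mono divide_right_mono mult_right_mono) auto
      finally have "- (2 * \<mu> * (Q * v t * z t)) \<le> Q / 2 * (v t)\<^sup>2 + k * (z t)\<^sup>2 / 2"
        by (simp add: mult_ac)
      moreover have "Q * 1 * (v t)\<^sup>2 \<le> Q * \<psi> t * (v t)\<^sup>2"
        using hyp[OF that] pos by (intro mult_right_mono mult_left_mono) auto
      ultimately have "Q / 2 * (v t)\<^sup>2 + k / 2 * (z t)\<^sup>2 \<le> F t" unfolding F_def by simp
      moreover have "l * (v t)\<^sup>2 + l * (z t)\<^sup>2 \<le> Q / 2 * (v t)\<^sup>2 + k / 2 * (z t)\<^sup>2"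
        unfolding l_def by (intro add_mono mult_right_mono) auto
      ultimately show ?thesis by (simp add: distrib_left)
    qed
    have step: "F (Suc t) - F t \<le> - c * F (Suc t) + C * M\<^sup>2" if "t \<ge> N" for t
    proof -
      have "F (Suc t) - F t \<le> - (d0 / 2) * (v (Suc t))\<^sup>2 - (\<mu> * k / 2) * (z (Suc t))\<^sup>2 + C * (e (Suc t))\<^sup>2"
        unfolding F_def C_def using hyp[OF that] hyp[of "Suc t"] that pos \<mu> \<mu>R
        by (intro lyapunov_step[where d = "d (Suc t)" and ?d1.0 = d1]) (auto simp: R_def)
      also have "\<dots> \<le> - h * (v (Suc t))\<^sup>2 - h * (z (Suc t))\<^sup>2 + C * M\<^sup>2"
      proof -
        have "(e (Suc t))\<^sup>2 \<le> M\<^sup>2"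
          using hyp[of "Suc t"] that by (metis abs_le_square_iff abs_of_nonneg \<open>M \<ge> 0\<close> le_SucI)
        then have "C * (e (Suc t))\<^sup>2 \<le> C * M\<^sup>2" using hHl by (intro mult_left_mono)
        moreover have "h * (v (Suc t))\<^sup>2 \<le> d0 / 2 * (v (Suc t))\<^sup>2" "h * (z (Suc t))\<^sup>2 \<le> \<mu> * k / 2 * (z (Suc t))\<^sup>2"
          unfolding h_def by (intro mult_right_mono; simp)+
        ultimately show ?thesis by simp
      qed
      also have "\<dots> = - c * (H * ((v (Suc t))\<^sup>2 + (z (Suc t))\<^sup>2)) + C * M\<^sup>2"
        using hHl unfolding c_def by (simp add: algebra_simps)
      also have "\<dots> \<le> - c * F (Suc t) + C * M\<^sup>2"
        using mult_left_mono[OF upper[of "Suc t"], of c] that hHl by simp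
      finally show ?thesis .
    qed
    \<comment> \<open>The slack \<open>l * \<delta>\<^sup>2\<close> becomes
      \<open>\<delta>\<^sup>2\<close> after division by \<open>l\<close>, and is then absorbed into
      \<open>(A * M + \<delta>)\<^sup>2\<close>.\<close>
    have ev: "\<forall>\<^sub>F t in sequentially. F t \<le> C * M\<^sup>2 / c + l * \<delta>\<^sup>2"
      by (rule contraction_eventually_le[where N = N]) (use hHl \<open>\<delta> > 0\<close> step in auto)
    have "\<forall>\<^sub>F t in sequentially. (v t)\<^sup>2 + (z t)\<^sup>2 \<le> (A * M + \<delta>)\<^sup>2"
      using ev eventually_ge_at_top[of N]
    proof eventually_elim
      case (elim t)
      have "l * ((v t)\<^sup>2 + (z t)\<^sup>2) \<le> C * M\<^sup>2 / c + l * \<delta>\<^sup>2"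
        using lower[of t] elim by simp
      also have "\<dots> = l * ((A * M)\<^sup>2 + \<delta>\<^sup>2)"
        unfolding A_def using hHl by (simp add: power_mult_distrib field_simps)
      finally have "(v t)\<^sup>2 + (z t)\<^sup>2 \<le> (A * M)\<^sup>2 + \<delta>\<^sup>2" using hHl by simp
      also have "\<dots> \<le> (A * M + \<delta>)\<^sup>2"
        using \<open>A \<ge> 0\<close> \<open>M \<ge> 0\<close> \<open>\<delta> > 0\<close> by (simp add: power2_sum)
      finally show ?case .
    qed
    then show ?thesis
    proof eventually_elim
      case (elim t)
      have nn: "0 \<le> A * M + \<delta>" using \<open>A \<ge> 0\<close> \<open>M \<ge> 0\<close> \<open>\<delta> > 0\<close> by simp
      have "(v t)\<^sup>2 \<le> (A * M + \<delta>)\<^sup>2" "(z t)\<^sup>2 \<le> (A * M + \<delta>)\<^sup>2"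
        using elim zero_le_power2[of "v t"] zero_le_power2[of "z t"] by linarith+
      then show ?case using nn by (simp add: abs_le_square_iff[symmetric])
    qed
  qed
  ultimately show ?thesis by blast
qed

section \<open>The stop operator\<close>

lemma abs_saturation_le: "\<rho> \<ge> 0 \<Longrightarrow> \<bar>saturation \<rho> v\<bar> \<le> \<rho>"
  unfolding saturation_def by auto

text \<open>For \<open>v = 0\<close> also \<open>s' = s\<close>, and the ratio is \<open>0 / 0 = 0\<close>.\<close>

lemma stop_ratio:
  fixes s s' v \<rho> :: real
  assumes "\<bar>s\<bar> \<le> \<rho>" "s' = saturation \<rho> (s + v)"
  shows "s' - s = (s' - s) / v * v" "0 \<le> (s' - s) / v" "(s' - s) / v \<le> 1"
  using assms unfolding saturation_def
  by (auto simp: divide_le_eq zero_le_divide_iff split: if_splits)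

text \<open>An increase forces the first ratio below 1, so saturation was active and
  \<open>s'\<close> sits at the end of the interval to which \<open>v\<close> points. A further move
  in the same direction leaves \<open>s'\<close> fixed and makes the second ratio 0, although it
  must be positive.\<close>

lemma stop_ratio_increase:
  fixes s s' s'' v v' \<rho> :: real
  assumes "\<bar>s\<bar> \<le> \<rho>" "s' = saturation \<rho> (s + v)" "s'' = saturation \<rho> (s' + v')"
    and "(s' - s) / v < (s'' - s') / v'"
  shows "v' * v \<le> 0"
proof (rule ccontr)
  assume *: "\<not> v' * v \<le> 0"
  have s': "\<bar>s'\<bar> \<le> \<rho>" using assms(1,2) by (auto simp: abs_saturation_le)
  have r: "(s' - s) / v < 1" "0 < (s'' - s') / v'"
    using assms(4) stop_ratio(2,3)[OF assms(1,2)] stop_ratio(2,3)[OF s' assms(3)] by linarith+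
  have "s' \<noteq> s + v" using r(1) * by (cases "v = 0") auto
  then have "s' = \<rho> \<and> v \<ge> 0 \<or> s' = - \<rho> \<and> v \<le> 0"
    using assms(1,2) unfolding saturation_def by (auto split: if_splits)
  moreover have "v > 0 \<and> v' > 0 \<or> v < 0 \<and> v' < 0" using * by (auto simp: not_le zero_less_mult_iff)
  ultimately have "s'' = s'" using assms(1,3) unfolding saturation_def by auto
  then show False using r(2) by simp
qed

section \<open>Limit superior and noise bounds\<close>

lemma limsup_ereal_le:
  fixes f :: "nat \<Rightarrow> real"
  assumes "\<And>\<delta>. \<delta> > 0 \<Longrightarrow> \<forall>\<^sub>F t in sequentially. f t \<le> L + \<delta>"
  shows "limsup (\<lambda>t. ereal (f t)) \<le> ereal L"
proof (rule ereal_le_epsilon2)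
  fix \<delta> :: real assume "0 < \<delta>"
  then show "limsup (\<lambda>t. ereal (f t)) \<le> ereal L + ereal \<delta>"
    using assms[of \<delta>] by (intro Limsup_bounded) simp
qed

lemma noise_le_noise_sup:
  assumes "bounded_noise \<eta> \<epsilon> \<xi>" "t \<ge> 1"
  shows "\<bar>\<epsilon> t\<bar> \<le> noise_sup \<eta> \<epsilon> \<xi>" "\<bar>\<eta> t\<bar> \<le> noise_sup \<eta> \<epsilon> \<xi>" "\<bar>\<xi> t\<bar> \<le> noise_sup \<eta> \<epsilon> \<xi>"
proof -
  have "noise_at \<eta> \<epsilon> \<xi> t \<le> noise_sup \<eta> \<epsilon> \<xi>"
    using assms unfolding bounded_noise_def noise_sup_def by (intro cSUP_upper) auto
  then show "\<bar>\<epsilon> t\<bar> \<le> noise_sup \<eta> \<epsilon> \<xi>" "\<bar>\<eta> t\<bar> \<le> noise_sup \<eta> \<epsilon> \<xi>" "\<bar>\<xi> t\<bar> \<le> noise_sup \<eta> \<epsilon> \<xi>"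
    unfolding noise_at_def by auto
qed

section \<open>Reduction of the system to the oscillator\<close>

theorem theorem3p2:
  fixes a1 a2 b1 b2 c1 c2 :: real
  assumes "0 \<le> a1" "a1 < 1" "0 < b1" "b1 < 1" "a2 > 0" "b2 > 0" "c2 > 0" "c1 > 1"
  shows "\<exists>L1 L2 :: real.
    \<forall>(\<rho>::real) (\<sigma>::real) (\<eta> :: nat \<Rightarrow> real) (\<epsilon> :: nat \<Rightarrow> real) (\<xi> :: nat \<Rightarrow> real)
      (x :: nat \<Rightarrow> real) (y :: nat \<Rightarrow> real) (p :: nat \<Rightarrow> real) (r :: nat \<Rightarrow> real) (g :: nat \<Rightarrow> real).
      \<rho> > 0 \<longrightarrow> \<sigma> \<ge> 0 \<longrightarrow> bounded_noise \<eta> \<epsilon> \<xi> \<longrightarrow>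
      trajectory a1 a2 b1 b2 c1 c2 \<rho> \<sigma> \<eta> \<epsilon> \<xi> x y p r g \<longrightarrow>
      limsup (\<lambda>t. ereal \<bar>x t - x_star a1 a2 b1 b2 c1 c2 (x t - p t)\<bar>)
        \<le> ereal (L1 * \<sigma> + L2 * noise_sup \<eta> \<epsilon> \<xi>) \<and>
      limsup (\<lambda>t. ereal \<bar>y t - y_star b1 b2 (x t - p t)\<bar>)
        \<le> ereal (L1 * \<sigma> + L2 * noise_sup \<eta> \<epsilon> \<xi>)"
proof -
  \<comment> \<open>The first equation reads
    \<open>B * v t = y t - \<gamma> * s t + \<eta> t / b2\<close>. In the second, written for
    \<open>(1 - a1) * (y t - y (t - 1))\<close>, the coefficients of \<open>y t\<close> and
    \<open>x t\<close> are \<open>- D\<close> and \<open>- k\<close>.\<close>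
  define B where "B = (1 - b1) / b2"
  define \<gamma> where "\<gamma> = b1 / b2"
  define D where "D = a1 + a2 * c2"
  define k where "k = a2 * (c1 - 1)"
  define \<kappa> where "\<kappa> = kappa a1 a2 b1 b2 c1 c2"
  have B: "B > 0" and \<gamma>: "\<gamma> > 0" and D: "D > 0" and k: "k > 0"
    using assms by (auto simp: B_def \<gamma>_def D_def k_def add_nonneg_pos)
  \<comment> \<open>The equilibrium condition: \<open>D * y + k * x + a2 * u = 0\<close> at
    \<open>x = \<kappa> * u\<close>, \<open>y = \<gamma> * u\<close>.\<close>
  have k\<kappa>: "k * \<kappa> = - (D * \<gamma> + a2)"
    using assms unfolding k_def \<kappa>_def D_def \<gamma>_def kappa_def
    by (simp add: divide_simps) (simp add: algebra_simps)
  have \<kappa>: "\<kappa> < 0"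
    by (rule ccontr) (use k\<kappa> k D \<gamma> assms(5) mult_nonneg_nonneg[of k \<kappa>] mult_pos_pos[of D \<gamma>] in linarith)
  obtain A where A: "A \<ge> 0" and bound: "\<And>v z e \<psi> d M N \<delta>. \<delta> > 0 \<Longrightarrow>
    (\<And>t. t \<ge> N \<Longrightarrow> 1 \<le> \<psi> t \<and> \<psi> t \<le> 1 - \<kappa> \<and> D * B \<le> d t \<and> d t \<le> (1 - a1) * \<gamma> + D * B \<and> \<bar>e t\<bar> \<le> M \<and>
      (\<psi> t < \<psi> (Suc t) \<longrightarrow> v (Suc t) * v t \<le> 0) \<and>
      ((1 - a1) * B) * (v (Suc t) - v t) = - d (Suc t) * v (Suc t) - k * z (Suc t) + e (Suc t) \<and>
      z (Suc t) - z t = \<psi> (Suc t) * v (Suc t)) \<Longrightarrow>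
    (\<forall>\<^sub>F t in sequentially. \<bar>v t\<bar> \<le> A * M + \<delta> \<and> \<bar>z t\<bar> \<le> A * M + \<delta>)"
    using switched_oscillator_bound[of "(1 - a1) * B" k "D * B" "(1 - a1) * \<gamma> + D * B" "1 - \<kappa>"]
      B \<gamma> D k \<kappa> assms by (auto simp: less_imp_le)
  \<comment> \<open>The factor in \<open>\<bar>e t\<bar> \<le> E * (\<sigma> + m)\<close>, collected
    from the terms of the forcing \<open>e\<close> below.\<close>
  define E where "E = 1 + a2 + (2 * (1 - a1) + D) / b2"
  have E: "E \<ge> 0" using assms D by (auto simp: E_def add_nonneg_nonneg)
  \<comment> \<open>The first entry serves \<open>x\<close>, the second \<open>y\<close>;
    \<open>L\<close> is the witness for both \<open>L1\<close> and \<open>L2\<close>.\<close>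
  define L where "L = max (A * E) (B * (A * E) + 1 / b2)"
  show ?thesis
  proof (intro exI[of _ L] allI impI)
    fix \<rho> \<sigma> :: real and \<eta> \<epsilon> \<xi> x y p r g :: "nat \<Rightarrow> real"
    assume "\<rho> > 0" "\<sigma> \<ge> 0" and bn: "bounded_noise \<eta> \<epsilon> \<xi>"
      and tr: "trajectory a1 a2 b1 b2 c1 c2 \<rho> \<sigma> \<eta> \<epsilon> \<xi> x y p r g"
    define m where "m = noise_sup \<eta> \<epsilon> \<xi>"
    have noise: "\<bar>\<epsilon> t\<bar> \<le> m" "\<bar>\<eta> t\<bar> \<le> m" "\<bar>\<xi> t\<bar> \<le> m" if "t \<ge> 1" for t
      using noise_le_noise_sup[OF bn that] by (auto simp: m_def)
    have "m \<ge> 0" using noise(1)[of 1] by simp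
    define s where "s t = x t - p t" for t
    define v where "v t = x t - x (t - 1)" for t
    define z where "z t = x t - \<kappa> * s t" for t
    define w where "w t = y t - \<gamma> * s t" for t
    define \<theta> where "\<theta> t = (s t - s (t - 1)) / v t" for t
    define \<psi> where "\<psi> t = 1 - \<kappa> * \<theta> t" for t
    define d where "d t = (1 - a1) * \<gamma> * \<theta> t + D * B" for t
    define \<delta> where "\<delta> t = r t - (c1 * x t + c2 * y t)" for t
    \<comment> \<open>The difference of \<open>\<eta>\<close> appears because \<open>w\<close> is
      replaced by \<open>B * v - \<eta> / b2\<close> at two consecutive times.\<close>
    define e where "e t = \<epsilon> t - a2 * \<delta> t + ((1 - a1) * (\<eta> t - \<eta> (t - 1)) + D * \<eta> t) / b2" for t
    have eqs: "x t = b1 * p t + (1 - b1) * x (t - 1) + b2 * y t + \<eta> t"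
        "y t = (1 - a1) * y (t - 1) - a2 * (r t - p t) + \<epsilon> t"
        "p t = x t + saturation \<rho> (p (t - 1) - x t)"
        "r t = g t + \<xi> t"
        "g t = (c1 * x t + c2 * y t) + saturation \<sigma> (g (t - 1) - (c1 * x t + c2 * y t))"
      if "t \<ge> 1" for t
      using tr that unfolding trajectory_def by blast+
    \<comment> \<open>The equation for \<open>p\<close> becomes a stop operator with input
      \<open>x\<close>, since \<open>saturation \<rho>\<close> is odd.\<close>
    have s_step: "s t = saturation \<rho> (s (t - 1) + v t)" if "t \<ge> 1" for t
    proof -
      have "s t = - saturation \<rho> (p (t - 1) - x t)" using eqs(3)[OF that] by (simp add: s_def)
      also have "\<dots> = saturation \<rho> (x t - p (t - 1))"
        using \<open>\<rho> > 0\<close> unfolding saturation_def by auto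
      finally show ?thesis by (simp add: s_def v_def)
    qed
    have s_le: "\<bar>s t\<bar> \<le> \<rho>" for t
    proof (cases "t = 0")
      case True
      then show ?thesis using tr by (simp add: trajectory_def s_def)
    next
      case False
      then show ?thesis using s_step[of t] abs_saturation_le[of \<rho>] \<open>\<rho> > 0\<close> by simp
    qed
    have \<theta>: "s t - s (t - 1) = \<theta> t * v t" "0 \<le> \<theta> t" "\<theta> t \<le> 1" if "t \<ge> 1" for t
      using stop_ratio[OF s_le[of "t - 1"] s_step[OF that]] unfolding \<theta>_def by blast+
    have \<delta>: "\<bar>\<delta> t\<bar> \<le> \<sigma> + m" if "t \<ge> 1" for t
      using eqs(4,5)[OF that] noise(3)[OF that]
        abs_saturation_le[OF \<open>\<sigma> \<ge> 0\<close>, of "g (t - 1) - (c1 * x t + c2 * y t)"]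
      unfolding \<delta>_def by linarith
    have v_w: "B * v t = w t + \<eta> t / b2" if "t \<ge> 1" for t
      using eqs(1)[OF that] assms unfolding B_def v_def w_def \<gamma>_def s_def
      by (simp add: field_simps)
    \<comment> \<open>Passing to deviations from equilibrium removes \<open>s t\<close> itself from
      the second equation; only its increment remains.\<close>
    have w_step: "(1 - a1) * (w t - w (t - 1)) + (1 - a1) * \<gamma> * (s t - s (t - 1))
      = - D * w t - k * z t + \<epsilon> t - a2 * \<delta> t" if "t \<ge> 1" for t
    proof -
      have "- D * w t - k * z t = - D * y t - k * x t + (D * \<gamma> + k * \<kappa>) * s t"
        unfolding w_def z_def by (simp add: algebra_simps)
      also have "\<dots> = - D * y t - k * x t - a2 * s t" unfolding k\<kappa> by (simp add: algebra_simps)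
      finally have *: "- D * w t - k * z t = - D * y t - k * x t - a2 * s t" .
      show ?thesis
        unfolding * using eqs(2)[OF that]
        unfolding w_def \<delta>_def D_def k_def s_def by (simp add: algebra_simps)
    qed
    \<comment> \<open>From time 2 on, because \<open>e t\<close> contains
      \<open>\<eta> (t - 1)\<close> and \<open>\<eta> 0\<close> is arbitrary.\<close>
    have e_le: "\<bar>e t\<bar> \<le> E * (\<sigma> + m)" if "t \<ge> 2" for t
    proof -
      have "\<bar>a2 * \<delta> t\<bar> \<le> a2 * (\<sigma> + m)" unfolding abs_mult using \<delta>[of t] assms that by simp
      moreover have "\<bar>(1 - a1) * (\<eta> t - \<eta> (t - 1))\<bar> \<le> (1 - a1) * (2 * m)"
      proof -
        have "\<bar>\<eta> t - \<eta> (t - 1)\<bar> \<le> 2 * m" using noise(2)[of t] noise(2)[of "t - 1"] that by linarith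
        then show ?thesis unfolding abs_mult using assms by simp
      qed
      moreover have "\<bar>D * \<eta> t\<bar> \<le> D * m" unfolding abs_mult using noise(2)[of t] D that by simp
      ultimately have "\<bar>(1 - a1) * (\<eta> t - \<eta> (t - 1)) + D * \<eta> t\<bar> \<le> (2 * (1 - a1) + D) * m"
        "\<bar>\<epsilon> t - a2 * \<delta> t\<bar> \<le> m + a2 * (\<sigma> + m)"
        using noise(1)[of t] that by (auto simp: algebra_simps)
      moreover have "(2 * (1 - a1) + D) * m \<le> (2 * (1 - a1) + D) * (\<sigma> + m)"
        using \<open>\<sigma> \<ge> 0\<close> D assms by (intro mult_left_mono) auto
      ultimately have "\<bar>(1 - a1) * (\<eta> t - \<eta> (t - 1)) + D * \<eta> t\<bar> / b2 \<le> (2 * (1 - a1) + D) * (\<sigma> + m) / b2"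
        using assms by (intro divide_right_mono) auto
      then have "\<bar>((1 - a1) * (\<eta> t - \<eta> (t - 1)) + D * \<eta> t) / b2\<bar> \<le> (2 * (1 - a1) + D) / b2 * (\<sigma> + m)"
        using assms by (simp add: abs_divide)
      with \<open>\<bar>\<epsilon> t - a2 * \<delta> t\<bar> \<le> m + a2 * (\<sigma> + m)\<close>
      have "\<bar>e t\<bar> \<le> (m + a2 * (\<sigma> + m)) + (2 * (1 - a1) + D) / b2 * (\<sigma> + m)"
        unfolding e_def by (intro order_trans[OF abs_triangle_ineq] add_mono)
      also have "\<dots> \<le> E * (\<sigma> + m)"
        using \<open>\<sigma> \<ge> 0\<close> unfolding E_def distrib_right[of _ _ "\<sigma> + m"] by simp
      finally show ?thesis .
    qed
    have ev: "\<forall>\<^sub>F t in sequentially. \<bar>v t\<bar> \<le> A * (E * (\<sigma> + m)) + \<delta>' \<and> \<bar>z t\<bar> \<le> A * (E * (\<sigma> + m)) + \<delta>'"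
      if "\<delta>' > 0" for \<delta>'
    proof (rule bound[where N = 2 and \<psi> = \<psi> and d = d and e = e, OF that])
      fix t :: nat assume t: "t \<ge> 2"
      have \<theta>t: "0 \<le> \<theta> t" "\<theta> t \<le> 1" using \<theta>[of t] t by auto
      have "\<kappa> * \<theta> t \<le> 0" "\<kappa> \<le> \<kappa> * \<theta> t"
        using \<kappa> \<theta>t mult_left_mono_neg[of "\<theta> t" 1 \<kappa>] by (auto simp: mult_nonpos_nonneg)
      then have "1 \<le> \<psi> t" "\<psi> t \<le> 1 - \<kappa>" unfolding \<psi>_def by auto
      moreover have "D * B \<le> d t" "d t \<le> (1 - a1) * \<gamma> + D * B"
        using \<theta>t \<gamma> assms unfolding d_def by (auto simp: mult_left_le)
      moreover have "v (Suc t) * v t \<le> 0" if "\<psi> t < \<psi> (Suc t)"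
      proof -
        \<comment> \<open>As \<open>\<kappa> < 0\<close>, the weight \<open>\<psi>\<close> grows
          exactly when the stop ratio \<open>\<theta>\<close> grows.\<close>
        have "\<theta> t < \<theta> (Suc t)" using that \<kappa> unfolding \<psi>_def by simp
        then show ?thesis
          using stop_ratio_increase[OF s_le[of "t - 1"] s_step[of t], of "s (Suc t)" "v (Suc t)"]
            s_step[of "Suc t"] t unfolding \<theta>_def by simp
      qed
      moreover have "((1 - a1) * B) * (v (Suc t) - v t)
        = - d (Suc t) * v (Suc t) - k * z (Suc t) + e (Suc t)"
      proof -
        have 1: "(1 - a1) * (w (Suc t) - w t) + (1 - a1) * \<gamma> * (\<theta> (Suc t) * v (Suc t))
          = - D * w (Suc t) - k * z (Suc t) + \<epsilon> (Suc t) - a2 * \<delta> (Suc t)"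
          using w_step[of "Suc t"] \<theta>(1)[of "Suc t"] by simp
        have 2: "w (Suc t) = B * v (Suc t) - \<eta> (Suc t) / b2" "w t = B * v t - \<eta> t / b2"
          using v_w[of "Suc t"] v_w[of t] t by auto
        show ?thesis using 1 unfolding 2 d_def e_def
          by (simp add: algebra_simps add_divide_distrib diff_divide_distrib)
      qed
      moreover have "z (Suc t) - z t = \<psi> (Suc t) * v (Suc t)"
      proof -
        have "z (Suc t) - z t = v (Suc t) - \<kappa> * (s (Suc t) - s t)"
          unfolding z_def v_def by (simp add: algebra_simps)
        then show ?thesis using \<theta>(1)[of "Suc t"] unfolding \<psi>_def by (simp add: algebra_simps)
      qed
      ultimately show "1 \<le> \<psi> t \<and> \<psi> t \<le> 1 - \<kappa> \<and> D * B \<le> d t \<and> d t \<le> (1 - a1) * \<gamma> + D * B \<and>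
        \<bar>e t\<bar> \<le> E * (\<sigma> + m) \<and> (\<psi> t < \<psi> (Suc t) \<longrightarrow> v (Suc t) * v t \<le> 0) \<and>
        ((1 - a1) * B) * (v (Suc t) - v t) = - d (Suc t) * v (Suc t) - k * z (Suc t) + e (Suc t) \<and>
        z (Suc t) - z t = \<psi> (Suc t) * v (Suc t)"
        using e_le[OF t] by blast
    qed

    \<comment> \<open>Bounds for the deviations from equilibrium\<close>
    have L: "A * E * (\<sigma> + m) \<le> L * (\<sigma> + m)" "(B * (A * E) + 1 / b2) * (\<sigma> + m) \<le> L * (\<sigma> + m)"
      unfolding L_def using \<open>\<sigma> \<ge> 0\<close> \<open>m \<ge> 0\<close> by (auto intro!: mult_right_mono)
    have "limsup (\<lambda>t. ereal \<bar>z t\<bar>) \<le> ereal (L * (\<sigma> + m))"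
    proof (rule limsup_ereal_le)
      fix \<delta>' :: real assume "\<delta>' > 0"
      from ev[OF this] show "\<forall>\<^sub>F t in sequentially. \<bar>z t\<bar> \<le> L * (\<sigma> + m) + \<delta>'"
      proof eventually_elim
        case (elim t)
        then show ?case using L(1) by (simp add: mult.assoc)
      qed
    qed
    moreover have "limsup (\<lambda>t. ereal \<bar>w t\<bar>) \<le> ereal (L * (\<sigma> + m))"
    proof (rule limsup_ereal_le)
      fix \<delta>' :: real assume "\<delta>' > 0"
      \<comment> \<open>The bound on \<open>w\<close> comes from
        \<open>w t = B * v t - \<eta> t / b2\<close>, so the tolerance for \<open>v\<close> is
        divided by \<open>B\<close>.\<close>
      then have "\<delta>' / B > 0" using B by simp
      from ev[OF this] eventually_ge_at_top[of 1]
      show "\<forall>\<^sub>F t in sequentially. \<bar>w t\<bar> \<le> L * (\<sigma> + m) + \<delta>'"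
      proof eventually_elim
        case (elim t)
        have "\<bar>B * v t\<bar> \<le> B * (A * (E * (\<sigma> + m)) + \<delta>' / B)"
          unfolding abs_mult using elim B by simp
        also have "\<dots> = B * (A * E) * (\<sigma> + m) + \<delta>'" using B by (simp add: algebra_simps)
        finally have 1: "\<bar>B * v t\<bar> \<le> B * (A * E) * (\<sigma> + m) + \<delta>'" .
        have "\<bar>\<eta> t\<bar> \<le> \<sigma> + m" using noise(2)[of t] elim \<open>\<sigma> \<ge> 0\<close> by simp
        then have "\<bar>\<eta> t / b2\<bar> \<le> 1 / b2 * (\<sigma> + m)"
          using assms by (simp add: abs_divide divide_right_mono)
        with 1 L(2) v_w[of t] elim show ?case unfolding distrib_right[of _ _ "\<sigma> + m"] by linarith
      qed
    qed
    ultimately show "limsup (\<lambda>t. ereal \<bar>x t - x_star a1 a2 b1 b2 c1 c2 (x t - p t)\<bar>)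
        \<le> ereal (L * \<sigma> + L * noise_sup \<eta> \<epsilon> \<xi>) \<and>
      limsup (\<lambda>t. ereal \<bar>y t - y_star b1 b2 (x t - p t)\<bar>)
        \<le> ereal (L * \<sigma> + L * noise_sup \<eta> \<epsilon> \<xi>)"
      unfolding x_star_def y_star_def z_def w_def s_def \<kappa>_def \<gamma>_def m_def by (simp add: distrib_left)
  qed
qed

end
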